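(* Fix an alphabet of size $k \geq 2$. There exist positive constants $c, C$ (depending only on $k$) such that: for every $n \geq 1$, the expected value of $\operatorname{ice}(x)$ for $x$ chosen uniformly at random among words of length $n$ lies in $[c, C]$; and the expected value of $\operatorname{ice}(\mathbf{x})$ for an infinite word $\mathbf{x}$ whose letters are chosen independently and uniformly at random also lies in $[c, C]$. That is, the expected value of the initial critical exponent of finite or infinite words is $\Theta(1)$.
   Context: For a finite nonempty word $w$, an integer $p$ with $1\le p\le |w|$ is a period of $w$ if $w[i]=w[i+p]$ for $1\le i\le |w|-p$; $\operatorname{per}(w)$ is the least period and $\exp(w)=|w|/\operatorname{per}(w)$. For a finite or infinite word $x$, the initial critical exponent is $\operatorname{ice}(x) = \sup\{\exp(w) : w \text{ a nonempty finite prefix of } x\}$. *)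

theory Defs
  imports "HOL-Probability.Probability" "HOL-Library.Sublist"
begin

text \<open>Words are 0-indexed: finite words are lists, infinite words are functions on \<open>nat\<close>.\<close>

definition is_period :: "nat \<Rightarrow> 'a list \<Rightarrow> bool" where
  "is_period p w \<longleftrightarrow>
     1 \<le> p \<and> p \<le> length w \<and> (\<forall>i. i + p < length w \<longrightarrow> w ! i = w ! (i + p))"

definition least_period :: "'a list \<Rightarrow> nat" where
  "least_period w = (LEAST p. is_period p w)"

definition word_exponent :: "'a list \<Rightarrow> real" where
  "word_exponent w = real (length w) / real (least_period w)"

definition ice_finite :: "'a list \<Rightarrow> ennreal" where
  "ice_finite x = (SUP w \<in> {w. prefix w x \<and> w \<noteq> []}. ennreal (word_exponent w))"

definition infinite_word_prefix :: "'a list \<Rightarrow> (nat \<Rightarrow> 'a) \<Rightarrow> bool" where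
  "infinite_word_prefix w x \<longleftrightarrow> (\<forall>i < length w. w ! i = x i)"

text \<open>Values in \<^typ>\<open>ennreal\<close>, since the supremum is infinite for, e.g., constant words.\<close>

definition ice_infinite :: "(nat \<Rightarrow> 'a) \<Rightarrow> ennreal" where
  "ice_infinite x = (SUP w \<in> {w. infinite_word_prefix w x \<and> w \<noteq> []}. ennreal (word_exponent w))"

definition random_word :: "'a set \<Rightarrow> nat \<Rightarrow> 'a list measure" where
  "random_word A n = uniform_count_measure {x. set x \<subseteq> A \<and> length x = n}"

definition random_infinite_word :: "'a set \<Rightarrow> (nat \<Rightarrow> 'a) measure" where
  "random_infinite_word A = (\<Pi>\<^sub>M i\<in>UNIV. uniform_count_measure A)"

end

theory Submission
  imports Defs
begin

text \<open>
  The lower bound \<open>c = 1\<close> comes from the prefix of length one. For the upper bound, a prefix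
  with period \<open>p\<close> and exponent \<open>e\<close> forces the \<open>\<lfloor>e\<rfloor> - 1\<close> events that the first \<open>(j + 1) p\<close> letters
  have period \<open>p\<close>, for \<open>1 \<le> j < \<lfloor>e\<rfloor>\<close>. Hence the initial critical exponent is at most 2 plus
  the number of pairs \<open>(p, j)\<close> whose event occurs. Such an event has probability
  at most \<open>(1/k)^(j p) \<le> (1/2)^(j + p - 1)\<close>, so the expected number of pairs is at most 2, and
  \<open>C = 4\<close> works.
\<close>

section \<open>Periodic prefixes and the exponent of a word\<close>

text \<open>Taking functions as arguments covers infinite words directly and lists through
  \<open>(!)\<close>. The parameter \<open>q\<close> counts the letter equations, so it becomes the
  exponent in the probability bounds; for \<open>p > 0\<close> the letters constrained are the first
  \<open>p + q\<close>.\<close>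

definition repeats :: "nat \<Rightarrow> nat \<Rightarrow> (nat \<Rightarrow> 'a) \<Rightarrow> bool" where
  "repeats p q x \<longleftrightarrow> (\<forall>i<q. x i = x (i + p))"

text \<open>Subtracting \<open>p\<close> from the position until it drops below \<open>p\<close>
  never changes the letter. Thus the first \<open>p\<close> letters determine the first
  \<open>p + q\<close>, which drives both the counting and the cylinder argument.\<close>

lemma repeats_mod:
  assumes "repeats p q x" "p > 0" "i < p + q"
  shows "x i = x (i mod p)"
  using assms(3)
proof (induction i rule: less_induct)
  case (less i)
  show ?case
  proof (cases "i < p")
    case False
    then have "x (i - p) = x i"
      using assms(1) less.prems by (auto simp: repeats_def)
    moreover have "x (i - p) = x ((i - p) mod p)"
      using less.IH[of "i - p"] less.prems assms(2) False by auto
    moreover have "(i - p) mod p = i mod p"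
      using False by (simp add: le_mod_geq)
    ultimately show ?thesis by simp
  qed simp
qed

lemma word_exponent_singleton: "word_exponent [a] = 1"
proof -
  have "is_period 1 [a]"
    by (simp add: is_period_def)
  moreover have "\<And>p. is_period p [a] \<Longrightarrow> 1 \<le> p"
    by (simp add: is_period_def)
  ultimately have "least_period [a] = 1"
    unfolding least_period_def by (rule Least_equality)
  then show ?thesis
    by (simp add: word_exponent_def)
qed

lemma is_period_least_period:
  assumes "w \<noteq> []"
  shows "is_period (least_period w) w"
proof -
  have "is_period (length w) w"
    using assms by (cases w) (auto simp: is_period_def)
  then show ?thesis
    unfolding least_period_def by (rule LeastI)
qed

text \<open>Only the row of the least period \<open>Suc p\<close> is needed: if \<open>e\<close>
  full periods fit into \<open>w\<close>, the exponent is below \<open>e + 1\<close>, and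
  \<open>x\<close> lies in \<open>S p j\<close> for each \<open>j < e - 1\<close>. The family
  \<open>S\<close> stays abstract so that finite and infinite words share the argument; its indices
  start at 0, hence period \<open>Suc p\<close> and prefix length
  \<open>Suc (Suc j) * Suc p\<close>.\<close>

lemma word_exponent_le_count:
  assumes "w \<noteq> []"
    and "\<And>p j. Suc (Suc j) * Suc p \<le> length w \<Longrightarrow> repeats (Suc p) (Suc j * Suc p) ((!) w)
           \<Longrightarrow> x \<in> S p j"
  shows "ennreal (word_exponent w) \<le> 2 + (\<Sum>p. \<Sum>j. indicator (S p j) x)"
proof -
  define m where "m = length w"
  define p where "p = least_period w - 1"
  have per: "is_period (Suc p) w"
    using is_period_least_period[OF assms(1)] by (auto simp: p_def is_period_def)
  have lp: "least_period w = Suc p"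
    using is_period_least_period[OF assms(1)] by (auto simp: p_def is_period_def)
  define e where "e = m div Suc p"
  have m_less: "m < Suc p * Suc e"
    using dividend_less_times_div[of "Suc p" m] by (simp add: e_def)
  have "real m < real (Suc p * Suc e)"
    using m_less by (simp only: of_nat_less_iff)
  then have "word_exponent w \<le> real (Suc e)"
    by (simp add: word_exponent_def lp m_def field_simps)
  also have "\<dots> \<le> 2 + real (e - 1)"
    by simp
  finally have "ennreal (word_exponent w) \<le> ennreal (2 + real (e - 1))"
    by (rule ennreal_leI)
  also have "\<dots> = 2 + of_nat (e - 1)"
    by (subst ennreal_plus) (auto simp: ennreal_of_nat_eq_real_of_nat)
  also have "(of_nat (e - 1) :: ennreal) = (\<Sum>j<e-1. indicator (S p j) x)"
  proof -
    have "x \<in> S p j" if "j < e - 1" for j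
    proof (rule assms(2))
      have "Suc (Suc j) * Suc p \<le> e * Suc p"
        using that by (intro mult_le_mono1) auto
      also have "\<dots> \<le> m"
        unfolding e_def by (rule div_times_less_eq_dividend)
      finally show le: "Suc (Suc j) * Suc p \<le> length w"
        by (simp add: m_def)
      show "repeats (Suc p) (Suc j * Suc p) ((!) w)"
        using per le by (auto simp: repeats_def is_period_def)
    qed
    then show ?thesis by simp
  qed
  also have "\<dots> \<le> (\<Sum>j. indicator (S p j) x)"
    by (rule sum_le_suminf) auto
  \<comment> \<open>Writing the row as a sum over a singleton lets \<open>sum_le_suminf\<close>
    embed it in the outer series.\<close>
  also have "\<dots> = (\<Sum>p'\<in>{p}. \<Sum>j. indicator (S p' j) x)"
    by simp
  also have "\<dots> \<le> (\<Sum>p. \<Sum>j. indicator (S p j) x)"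
    by (rule sum_le_suminf) auto
  finally show ?thesis by (simp add: add_mono)
qed

section \<open>From event probabilities to the expectation\<close>

lemma double_geometric_sum: "(\<Sum>p. \<Sum>j. ennreal ((1/2) ^ (Suc (p + j)))) = 2"
proof -
  have geo: "(\<Sum>j. ennreal ((1/2) ^ j)) = 2"
    by (subst suminf_ennreal2) (auto simp: suminf_geometric)
  have "(\<Sum>j. ennreal ((1/2) ^ (Suc (p + j)))) = ennreal ((1/2) ^ p)" for p
  proof -
    have "(\<Sum>j. ennreal ((1/2) ^ (Suc (p + j)))) = (\<Sum>j. ennreal ((1/2) ^ Suc p) * ennreal ((1/2) ^ j))"
      by (intro suminf_cong) (simp add: power_add flip: ennreal_mult)
    also have "\<dots> = ennreal ((1/2) ^ Suc p) * 2"
      by (simp add: geo del: power_Suc)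
    also have "\<dots> = ennreal ((1/2) ^ Suc p * 2)"
      by (subst ennreal_mult) auto
    finally show ?thesis by simp
  qed
  then show ?thesis by (simp only: geo)
qed

text \<open>The integral of the counting series is the double series of the probabilities, since all
  terms are nonnegative; comparison with the geometric double series gives 2 + 2.\<close>

lemma nn_integral_count_le_4:
  assumes "prob_space M" and [measurable]: "\<And>p j. S p j \<in> sets M"
    and le: "\<And>p j. emeasure M (S p j) \<le> ennreal ((1/2) ^ (Suc j * Suc p))"
    and f: "\<And>x. x \<in> space M \<Longrightarrow> f x \<le> 2 + (\<Sum>p. \<Sum>j. indicator (S p j) x)"
  shows "(\<integral>\<^sup>+x. f x \<partial>M) \<le> 4"
proof -
  interpret prob_space M by fact
  have "(\<integral>\<^sup>+x. f x \<partial>M) \<le> (\<integral>\<^sup>+x. 2 + (\<Sum>p. \<Sum>j. indicator (S p j) x) \<partial>M)"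
    by (intro nn_integral_mono f)
  also have "\<dots> = 2 + (\<Sum>p. \<Sum>j. emeasure M (S p j))"
    by (simp add: nn_integral_add nn_integral_suminf emeasure_space_1)
  also have "(\<Sum>p. \<Sum>j. emeasure M (S p j)) \<le> 2"
    unfolding double_geometric_sum[symmetric]
  proof (intro suminf_le)
    fix p j
    have "emeasure M (S p j) \<le> ennreal ((1/2) ^ (Suc j * Suc p))"
      by (rule le)
    \<comment> \<open>Here \<open>Suc j * Suc p\<close> exceeds \<open>Suc (p + j)\<close> by
      \<open>j * p\<close>; the weaker exponent makes the series split into geometric ones.\<close>
    also have "\<dots> \<le> ennreal ((1/2) ^ (Suc (p + j)))"
      by (intro ennreal_leI power_decreasing) auto
    finally show "emeasure M (S p j) \<le> ennreal ((1/2) ^ (Suc (p + j)))" .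
  qed auto
  finally show ?thesis
    by (simp add: add_left_mono)
qed

section \<open>Pointwise lower bounds\<close>

lemma ice_finite_ge_1:
  assumes "x \<noteq> []"
  shows "1 \<le> ice_finite x"
proof -
  have "ennreal (word_exponent [hd x]) \<le> ice_finite x"
    unfolding ice_finite_def using assms
    by (intro SUP_upper) (auto simp: prefix_def intro!: exI[of _ "tl x"])
  then show ?thesis
    by (simp add: word_exponent_singleton)
qed

lemma ice_infinite_ge_1: "1 \<le> ice_infinite x"
proof -
  have "ennreal (word_exponent [x 0]) \<le> ice_infinite x"
    unfolding ice_infinite_def by (intro SUP_upper) (auto simp: infinite_word_prefix_def)
  then show ?thesis
    by (simp add: word_exponent_singleton)
qed

section \<open>Upper bound for finite words\<close>

text \<open>Deleting the \<open>q\<close> letters at positions \<open>p\<close> to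
  \<open>p + q - 1\<close> is injective on these words, because the remaining first \<open>p\<close>
  letters restore them.\<close>

lemma card_repeats_le:
  assumes "finite A" "p > 0" "p + q \<le> n"
  shows "card {x. set x \<subseteq> A \<and> length x = n \<and> repeats p q ((!) x)} \<le> card A ^ (n - q)"
proof -
  let ?S = "{x. set x \<subseteq> A \<and> length x = n \<and> repeats p q ((!) x)}"
  let ?f = "\<lambda>x. take p x @ drop (p + q) x"
  have "inj_on ?f ?S"
  proof (rule inj_onI)
    fix x y assume x: "x \<in> ?S" and y: "y \<in> ?S" and eq: "?f x = ?f y"
    then have tk: "take p x = take p y" and dr: "drop (p + q) x = drop (p + q) y"
      using assms by (auto simp: append_eq_append_conv)
    have "take (p + q) x = take (p + q) y"
    proof (rule nth_equalityI)
      fix i assume "i < length (take (p + q) x)"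
      then have i: "i < p + q" by simp
      have "take p x ! (i mod p) = take p y ! (i mod p)"
        by (simp add: tk)
      then have "x ! (i mod p) = y ! (i mod p)"
        using assms by simp
      then show "take (p + q) x ! i = take (p + q) y ! i"
        using repeats_mod[of p q "(!) x" i] repeats_mod[of p q "(!) y" i] x y i assms by simp
    qed (use x y in auto)
    then show "x = y"
      using dr by (metis append_take_drop_id)
  qed
  moreover have "?f ` ?S \<subseteq> {x. set x \<subseteq> A \<and> length x = n - q}"
    using assms by (auto dest!: in_set_takeD in_set_dropD)
  ultimately have "card ?S \<le> card {x. set x \<subseteq> A \<and> length x = n - q}"
    using finite_lists_length_eq[OF assms(1)] by (rule card_inj_on_le)
  then show ?thesis
    by (simp add: card_lists_length_eq assms)
qed

lemma inverse_power_le_half_power: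
  assumes "k \<ge> 2"
  shows "ennreal (1 / real k ^ q) \<le> ennreal ((1/2) ^ q)"
proof -
  have "(1 / real k) ^ q \<le> (1/2) ^ q"
    using assms by (intro power_mono) (auto simp: field_simps)
  then show ?thesis
    by (intro ennreal_leI) (simp add: power_divide)
qed

lemma prob_space_random_word:
  assumes "finite A" "A \<noteq> {}"
  shows "prob_space (random_word A n)"
proof -
  have "card {x. set x \<subseteq> A \<and> length x = n} \<noteq> 0"
    using assms by (simp add: card_lists_length_eq)
  then have "{x. set x \<subseteq> A \<and> length x = n} \<noteq> {}"
    by (metis card.empty)
  then show ?thesis
    unfolding random_word_def
    by (intro prob_space_uniform_count_measure finite_lists_length_eq assms)
qed

lemma emeasure_random_word_repeats_le:
  assumes "finite A" "card A = k" "k \<ge> 2" "p > 0" "p + q \<le> n"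
  shows "emeasure (random_word A n) {x. set x \<subseteq> A \<and> length x = n \<and> repeats p q ((!) x)}
           \<le> ennreal ((1/2) ^ q)"
proof -
  let ?S = "{x. set x \<subseteq> A \<and> length x = n \<and> repeats p q ((!) x)}"
  have "emeasure (random_word A n) ?S = ennreal (real (card ?S) / real k ^ n)"
    unfolding random_word_def using assms
    by (subst emeasure_uniform_count_measure)
       (auto simp: card_lists_length_eq finite_lists_length_eq)
  also have "\<dots> \<le> ennreal (real k ^ (n - q) / real k ^ n)"
    using card_repeats_le[of A p q n] assms
    by (intro ennreal_leI divide_right_mono) (auto simp flip: of_nat_power)
  also have "real k ^ (n - q) / real k ^ n = 1 / real k ^ q"
    using assms by (simp add: power_diff field_simps)
  also have "ennreal \<dots> \<le> ennreal ((1/2) ^ q)"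
    by (rule inverse_power_le_half_power) fact
  finally show ?thesis .
qed

lemma nn_integral_ice_finite_le:
  assumes "finite A" "card A = k" "k \<ge> 2"
  shows "(\<integral>\<^sup>+x. ice_finite x \<partial>random_word A n) \<le> 4"
proof -
  \<comment> \<open>The length condition keeps all compared positions inside the word. Where it
    fails, the set is empty and its probability bound is trivial.\<close>
  define S where "S = (\<lambda>p j. {x. set x \<subseteq> A \<and> length x = n \<and>
    (Suc (Suc j) * Suc p \<le> n \<and> repeats (Suc p) (Suc j * Suc p) ((!) x))})"
  show ?thesis
  proof (rule nn_integral_count_le_4)
    show "prob_space (random_word A n)"
      using assms by (intro prob_space_random_word) auto
    show "S p j \<in> sets (random_word A n)" for p j
      by (auto simp: random_word_def sets_uniform_count_measure S_def)
    show "emeasure (random_word A n) (S p j) \<le> ennreal ((1/2) ^ (Suc j * Suc p))" for p j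
    proof (cases "Suc (Suc j) * Suc p \<le> n")
      case True
      then have "S p j =
          {x. set x \<subseteq> A \<and> length x = n \<and> repeats (Suc p) (Suc j * Suc p) ((!) x)}"
        by (simp add: S_def)
      then show ?thesis
        using emeasure_random_word_repeats_le[OF assms, of "Suc p" "Suc j * Suc p" n] True
        by simp
    next
      case False
      then have "S p j = {}"
        by (auto simp: S_def)
      then show ?thesis by simp
    qed
    show "ice_finite x \<le> 2 + (\<Sum>p. \<Sum>j. indicator (S p j) x)"
      if "x \<in> space (random_word A n)" for x
      unfolding ice_finite_def
    proof (rule SUP_least)
      fix w assume "w \<in> {w. prefix w x \<and> w \<noteq> []}"
      then obtain v where w: "w \<noteq> []" "x = w @ v"
        by (auto simp: prefix_def)
      from that have x: "set x \<subseteq> A" "length x = n"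
        by (auto simp: random_word_def space_uniform_count_measure)
      show "ennreal (word_exponent w) \<le> 2 + (\<Sum>p. \<Sum>j. indicator (S p j) x)"
      proof (rule word_exponent_le_count[OF w(1)])
        fix p j assume "Suc (Suc j) * Suc p \<le> length w"
          "repeats (Suc p) (Suc j * Suc p) ((!) w)"
        then show "x \<in> S p j"
          using x by (auto simp: S_def w(2) repeats_def nth_append)
      qed
    qed
  qed
qed

section \<open>Upper bound for infinite words\<close>

text \<open>The event is a finite union of cylinders, one for each of the \<open>k ^ p\<close>
  possible initial blocks of length \<open>p\<close>. Each cylinder fixes \<open>p + q\<close>
  letters, so the union bound leaves \<open>1 / k ^ q\<close>.\<close>

lemma emeasure_random_infinite_word_repeats_le:
  assumes "finite A" "card A = k" "k \<ge> 2" "p > 0"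
  shows "{x. range x \<subseteq> A \<and> repeats p q x} \<in> sets (random_infinite_word A)" (is "?S \<in> _")
    and "emeasure (random_infinite_word A) {x. range x \<subseteq> A \<and> repeats p q x}
           \<le> ennreal ((1/2) ^ q)"
proof -
  let ?U = "uniform_count_measure A"
  let ?M = "random_infinite_word A"
  have "A \<noteq> {}"
    using assms by auto
  interpret U: prob_space ?U
    by (rule prob_space_uniform_count_measure) fact+
  interpret product_prob_space "\<lambda>_::nat. ?U" UNIV
    by unfold_locales
  have space: "space ?M = {x. range x \<subseteq> A}"
    by (auto simp: random_infinite_word_def space_PiM space_uniform_count_measure PiE_def Pi_def)
  \<comment> \<open>\<open>C u\<close> is the cylinder of words that begin with the periodic
    continuation of the block \<open>u\<close> to length \<open>p + q\<close>.\<close>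
  define C where "C = (\<lambda>u. {x\<in>space ?M. \<forall>i\<in>{..<p+q}. x i \<in> {u (i mod p)}})"
  define V where "V = {..<p} \<rightarrow>\<^sub>E A"
  have V: "u (i mod p) \<in> A" if "u \<in> V" for u i
    using PiE_mem[of u "{..<p}" "\<lambda>_. A" "i mod p"] that assms by (simp add: V_def)
  have finV: "finite V"
    unfolding V_def by (intro finite_PiE) (use assms in auto)
  have cardV: "card V = k ^ p"
    using assms by (simp add: V_def card_PiE)
  have C_sets: "C u \<in> sets ?M" if "u \<in> V" for u
    unfolding C_def random_infinite_word_def
    using V[OF that]
    by (intro sets.sets_Collect_finite_All sets_Collect_single) (auto simp: sets_uniform_count_measure)
  have C_measure: "emeasure ?M (C u) = ennreal (1 / real k ^ (p + q))" if "u \<in> V" for u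
  proof -
    have "emeasure ?M (C u) = (\<Prod>i<p+q. emeasure ?U {u (i mod p)})"
      unfolding C_def random_infinite_word_def using V[OF that]
      by (intro emeasure_PiM_Collect) (auto simp: sets_uniform_count_measure)
    also have "\<dots> = (\<Prod>i<p+q. ennreal (1 / real k))"
      using V[OF that] assms by (intro prod.cong) (auto simp: emeasure_uniform_count_measure)
    finally show ?thesis
      by (simp add: ennreal_power power_divide)
  qed
  have "?S = (\<Union>u\<in>V. C u)"
  proof (intro equalityI subsetI)
    fix x assume x: "x \<in> ?S"
    \<comment> \<open>The cylinder containing \<open>x\<close> is that of its own first
      \<open>p\<close> letters, restricted because \<open>V\<close> consists of extensional
      functions.\<close>
    have "restrict x {..<p} \<in> V"
      using x by (auto simp: V_def)
    moreover have "x \<in> C (restrict x {..<p})"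
      using x repeats_mod[of p q x] assms by (auto simp: C_def space)
    ultimately show "x \<in> (\<Union>u\<in>V. C u)" by blast
  next
    fix x assume "x \<in> (\<Union>u\<in>V. C u)"
    then obtain u where "range x \<subseteq> A" "\<And>i. i < p + q \<Longrightarrow> x i = u (i mod p)"
      by (auto simp: C_def space)
    then show "x \<in> ?S"
      by (auto simp: repeats_def)
  qed
  moreover have "(\<Union>u\<in>V. C u) \<in> sets ?M"
    using C_sets finV by blast
  moreover have "emeasure ?M (\<Union>u\<in>V. C u) \<le> ennreal ((1/2) ^ q)"
  proof -
    have "emeasure ?M (\<Union>u\<in>V. C u) \<le> (\<Sum>u\<in>V. emeasure ?M (C u))"
      using C_sets finV by (intro emeasure_subadditive_finite) auto
    also have "\<dots> = of_nat (k ^ p) * ennreal (1 / real k ^ (p + q))"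
      by (simp add: C_measure cardV)
    also have "\<dots> = ennreal (real (k ^ p) * (1 / real k ^ (p + q)))"
      by (subst ennreal_mult) (auto simp: ennreal_of_nat_eq_real_of_nat)
    also have "real (k ^ p) * (1 / real k ^ (p + q)) = 1 / real k ^ q"
      using assms by (simp add: power_add)
    also have "ennreal \<dots> \<le> ennreal ((1/2) ^ q)"
      by (rule inverse_power_le_half_power) fact
    finally show ?thesis .
  qed
  ultimately show "?S \<in> sets ?M" "emeasure ?M ?S \<le> ennreal ((1/2) ^ q)"
    by simp_all
qed

lemma prob_space_random_infinite_word:
  assumes "finite A" "A \<noteq> {}"
  shows "prob_space (random_infinite_word A)"
  unfolding random_infinite_word_def
  by (intro prob_space_PiM prob_space_uniform_count_measure assms)

lemma nn_integral_ice_infinite_le: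
  assumes "finite A" "card A = k" "k \<ge> 2"
  shows "(\<integral>\<^sup>+x. ice_infinite x \<partial>random_infinite_word A) \<le> 4"
proof -
  define S where "S = (\<lambda>p j. {x. range x \<subseteq> A \<and> repeats (Suc p) (Suc j * Suc p) x})"
  show ?thesis
  proof (rule nn_integral_count_le_4)
    show "prob_space (random_infinite_word A)"
      using assms by (intro prob_space_random_infinite_word) auto
    show "S p j \<in> sets (random_infinite_word A)"
      and "emeasure (random_infinite_word A) (S p j) \<le> ennreal ((1/2) ^ (Suc j * Suc p))" for p j
      unfolding S_def by (intro emeasure_random_infinite_word_repeats_le[OF assms] zero_less_Suc)+
    show "ice_infinite x \<le> 2 + (\<Sum>p. \<Sum>j. indicator (S p j) x)"
      if "x \<in> space (random_infinite_word A)" for x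
      unfolding ice_infinite_def
    proof (rule SUP_least)
      fix w assume "w \<in> {w. infinite_word_prefix w x \<and> w \<noteq> []}"
      then have w: "w \<noteq> []" "\<And>i. i < length w \<Longrightarrow> w ! i = x i"
        by (auto simp: infinite_word_prefix_def)
      from that have x: "range x \<subseteq> A"
        by (auto simp: random_infinite_word_def space_PiM space_uniform_count_measure PiE_def Pi_def)
      show "ennreal (word_exponent w) \<le> 2 + (\<Sum>p. \<Sum>j. indicator (S p j) x)"
      proof (rule word_exponent_le_count[OF w(1)])
        fix p j assume "Suc (Suc j) * Suc p \<le> length w"
          "repeats (Suc p) (Suc j * Suc p) ((!) w)"
        then show "x \<in> S p j"
          using x by (auto simp: S_def w(2) repeats_def)
      qed
    qed
  qed
qed

section \<open>Combining the bounds into expectations between 1 and 4\<close>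

lemma nn_integral_ge_1:
  assumes "prob_space M" "\<And>x. x \<in> space M \<Longrightarrow> 1 \<le> f x"
  shows "1 \<le> (\<integral>\<^sup>+x. f x \<partial>M)"
proof -
  have "1 = (\<integral>\<^sup>+x. 1 \<partial>M)"
    using prob_space.emeasure_space_1[OF assms(1)] by simp
  also have "\<dots> \<le> (\<integral>\<^sup>+x. f x \<partial>M)"
    by (intro nn_integral_mono assms)
  finally show ?thesis .
qed

theorem theorem4:
  fixes k :: nat
  assumes "k \<ge> 2"
  shows "\<exists>c C :: real. 0 < c \<and> 0 < C \<and>
    (\<forall>A :: 'a set. finite A \<and> card A = k \<longrightarrow>
      (\<forall>n \<ge> 1. (\<integral>\<^sup>+ x. ice_finite x \<partial>random_word A n) \<in> {ennreal c..ennreal C}) \<and>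
      (\<integral>\<^sup>+ x. ice_infinite x \<partial>random_infinite_word A) \<in> {ennreal c..ennreal C})"
proof (rule exI[of _ 1], rule exI[of _ 4], intro conjI allI impI)
  fix A :: "'a set" assume "finite A \<and> card A = k"
  then have A: "finite A" "card A = k" "A \<noteq> {}"
    using assms by auto
  show "(\<integral>\<^sup>+ x. ice_finite x \<partial>random_word A n) \<in> {ennreal 1..ennreal 4}" if "n \<ge> 1" for n
  proof -
    \<comment> \<open>Positive length excludes the empty word, where the supremum over no prefixes
      would be 0.\<close>
    have "1 \<le> ice_finite x" if "x \<in> space (random_word A n)" for x
      using that \<open>n \<ge> 1\<close>
      by (intro ice_finite_ge_1) (auto simp: random_word_def space_uniform_count_measure)
    then show ?thesis
      using nn_integral_ge_1[OF prob_space_random_word[OF A(1,3)]]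
        nn_integral_ice_finite_le[OF A(1,2) assms] by simp
  qed
  show "(\<integral>\<^sup>+ x. ice_infinite x \<partial>random_infinite_word A) \<in> {ennreal 1..ennreal 4}"
    using nn_integral_ge_1[OF prob_space_random_infinite_word[OF A(1,3)] ice_infinite_ge_1]
      nn_integral_ice_infinite_le[OF A(1,2) assms] by simp
qed simp_all

end
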